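(* For every real $t$ with $-1\le t<\tfrac12$, $$\sum_{k=0}^{\infty}c_k t^k=\frac{1}{1-t}\sum_{k=0}^{\infty}\left(-\frac{t}{1-t}\right)^k\frac{1}{\zeta(2k+2)},$$ where infinite sums are limits of partial sums (and both converge).
   Context: Let $\zeta$ denote the Riemann zeta function. For integers $k\ge 0$ define the Báez-Duarte sequence $$c_k=\sum_{j=0}^{k}(-1)^j\binom{k}{j}\frac{1}{\zeta(2j+2)}.$$ The convention $0^0=1$ is used in the $k=0$ terms when $t=0$. *)

theory Defs
  imports "HOL-Complex_Analysis.Complex_Analysis"
begin

definition zeta_series :: "complex \<Rightarrow> complex" where
  "zeta_series s = (\<Sum>n. 1 / of_nat (Suc n) powr s)"

(* Analytic continuation is unique, but only up to the value at the pole 1,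
   which is fixed here by the convention zeta(1) = 0. *)
definition riemann_zeta :: "complex \<Rightarrow> complex" where
  "riemann_zeta s =
     (if Re s > 1 then zeta_series s
      else (THE f. f holomorphic_on (- {1}) \<and> f 1 = 0 \<and>
              (\<forall>z. Re z > 1 \<longrightarrow> f z = zeta_series z)) s)"

definition baez_duarte :: "nat \<Rightarrow> complex" where
  "baez_duarte k =
     (\<Sum>j=0..k. (-1) ^ j * of_nat (k choose j) * (1 / riemann_zeta (2 * of_nat j + 2)))"

end

theory Submission
  imports Defs "HOL-Computational_Algebra.Squarefree"
begin

text \<open>
  Since \<open>1 / \<zeta>(s) = (\<Sum>n\<ge>1. \<mu>(n) / n^s)\<close>, the numbers \<open>b k = 1 / \<zeta>(2 k + 2)\<close> are the moments
  \<open>\<Sum>n. a n * y n ^ k\<close> of the absolutely summable weights \<open>a n = \<mu>(n) / n^2\<close> at the points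
  \<open>y n = 1 / n^2\<close> of \<open>(0, 1]\<close>. By the binomial theorem the numbers \<open>c k\<close> are the moments of the same
  weights at the points \<open>1 - y n\<close>. So both power series are mixtures of geometric series,
  with ratios \<open>t * (1 - y n)\<close> on the left and \<open>x * y n\<close> with \<open>x = - t / (1 - t)\<close> on the right, and
  the theorem reduces to the identity
  \<open>1 / (1 - t * (1 - y)) = (1 / (1 - t)) * (1 / (1 - x * y))\<close> for each single point \<open>y\<close>.

  What needs care is the exchange of the two summations, above all at \<open>t = -1\<close>. The ratios on the
  left then accumulate at \<open>-1\<close>, and \<open>\<Sum>k. norm (t * (1 - y n)) ^ k = n^2\<close>, so that the series
  of absolute values reduces to \<open>\<Sum>n. norm (\<mu>(n))\<close>, which diverges. The exchange is therefore made on the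
  partial sums over \<open>k\<close>, which are the closed forms \<open>a n * (1 - z^K) / (1 - z)\<close>. They are bounded by a
  multiple of \<open>norm (a n)\<close> as soon as the ratios \<open>z\<close> lie in the open unit disc and stay away from \<open>1\<close>,
  and Tannery's theorem (dominated convergence) applies; this is \<open>sums_geometric_mixture\<close>.

  The representation of \<open>1 / \<zeta>\<close> is \<open>inverse_zeta_even_sums\<close>. It rests on
  \<open>(\<Sum>d | d dvd n. \<mu>(d)) = 0\<close> for \<open>n > 1\<close> and on a rearrangement of the double series
  \<open>\<Sum>\<mu>(d) / (d e)^s\<close>.
\<close>

section \<open>The Moebius function\<close>

definition moebius_mu :: "nat \<Rightarrow> complex" where
  "moebius_mu n = (if squarefree n then (-1) ^ card (prime_factors n) else 0)"

lemma norm_moebius_mu_le: "norm (moebius_mu n) \<le> 1"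
  by (simp add: moebius_mu_def norm_power)

lemma moebius_mu_prime_mult:
  assumes "prime p" "\<not> p dvd d" "d > 0"
  shows   "moebius_mu (p * d) = - moebius_mu d"
proof -
  have "coprime p d"
    using assms by (simp add: prime_imp_coprime)
  hence sqf: "squarefree (p * d) \<longleftrightarrow> squarefree d"
    using assms squarefree_multD squarefree_mult_coprime squarefree_prime by blast
  have "prime_factors (p * d) = insert p (prime_factors d)"
    using assms prime_gt_0_nat[of p] by (simp add: prime_factors_product prime_prime_factors)
  moreover have "p \<notin> prime_factors d"
    using assms by auto
  ultimately have "card (prime_factors (p * d)) = Suc (card (prime_factors d))"
    by simp
  with sqf show ?thesis
    by (simp add: moebius_mu_def)
qed

text \<open>
  Fix a prime \<open>p\<close> dividing \<open>n\<close>. Multiplication by \<open>p\<close> pairs the squarefree divisors of \<open>n\<close> prime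
  to \<open>p\<close> with those divisible by \<open>p\<close>, and it changes the sign of the Moebius function.
\<close>
lemma sum_moebius_mu_divisors:
  assumes "n > 0"
  shows   "(\<Sum>d | d dvd n. moebius_mu d) = (if n = 1 then 1 else 0)"
proof (cases "n = 1")
  case True
  thus ?thesis by (simp add: moebius_mu_def)
next
  case False
  then obtain p where p: "prime p" "p dvd n"
    using prime_factor_nat by blast
  define A where "A = {d. d dvd n \<and> squarefree d \<and> \<not> p dvd d}"
  define B where "B = {d. d dvd n \<and> squarefree d \<and> p dvd d}"
  have fin: "finite {d. d dvd n}"
    using assms by simp
  have "finite A" "finite B"
    by (rule finite_subset[OF _ fin]; auto simp: A_def B_def)+
  have A_pos: "d > 0" if "d \<in> A" for d
    using that assms by (auto simp: A_def intro: Nat.gr0I)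
  have B_eq: "B = (*) p ` A"
  proof (intro equalityI subsetI)
    fix d assume d: "d \<in> B"
    then obtain e where e: "d = p * e"
      by (auto simp: B_def)
    have "\<not> p dvd e"
    proof
      assume "p dvd e"
      hence "p ^ 2 dvd d"
        by (auto simp: e power2_eq_square)
      with d have "is_unit p"
        unfolding B_def squarefree_def by blast
      with p show False
        by auto
    qed
    moreover have "squarefree e" "e dvd n"
      using d by (auto simp: B_def e dest: squarefree_multD dvd_mult_right)
    ultimately show "d \<in> (*) p ` A"
      by (auto simp: A_def e)
  next
    fix d assume "d \<in> (*) p ` A"
    then obtain e where e: "d = p * e" "e \<in> A"
      by auto
    have cop: "coprime p e"
      using p e by (simp add: A_def prime_imp_coprime)
    have "d dvd n"
      unfolding e using p e cop by (auto simp: A_def intro: divides_mult)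
    moreover have "squarefree d"
      unfolding e using p e cop by (auto simp: A_def intro: squarefree_mult_coprime squarefree_prime)
    ultimately show "d \<in> B"
      by (simp add: B_def e)
  qed
  have "inj_on ((*) p) A"
    using p prime_gt_0_nat[of p] by (auto simp: inj_on_def)
  hence "sum moebius_mu B = (\<Sum>d\<in>A. moebius_mu (p * d))"
    by (simp add: B_eq sum.reindex)
  also have "\<dots> = (\<Sum>d\<in>A. - moebius_mu d)"
    by (intro sum.cong refl moebius_mu_prime_mult) (use p A_pos in \<open>auto simp: A_def\<close>)
  finally have "sum moebius_mu A + sum moebius_mu B = 0"
    by (simp add: sum_negf)
  moreover have "sum moebius_mu (A \<union> B) = sum moebius_mu A + sum moebius_mu B"
    by (rule sum.union_disjoint) (use \<open>finite A\<close> \<open>finite B\<close> in \<open>auto simp: A_def B_def\<close>)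
  moreover have "(\<Sum>d | d dvd n. moebius_mu d) = sum moebius_mu (A \<union> B)"
    by (rule sum.mono_neutral_right[OF fin]) (auto simp: A_def B_def moebius_mu_def)
  ultimately show ?thesis
    using False by simp
qed

section \<open>The Dirichlet series of the reciprocal zeta function\<close>

lemma summable_inverse_Suc_power:
  assumes "s \<ge> 2"
  shows   "summable (\<lambda>n. norm (1 / of_nat (Suc n) ^ s :: complex))"
proof -
  have "summable (\<lambda>n. inverse (real (Suc n) ^ s))"
    using inverse_power_summable[OF assms, where 'a = real] by (subst summable_Suc_iff)
  thus ?thesis
    by (simp add: norm_divide norm_power inverse_eq_divide del: of_nat_Suc)
qed

lemma summable_bounded_mult:
  fixes a z :: "nat \<Rightarrow> complex"
  assumes "summable (\<lambda>n. norm (a n))" "\<And>n. norm (z n) \<le> C"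
  shows   "summable (\<lambda>n. norm (z n * a n))"
proof (rule summable_comparison_test')
  show "summable (\<lambda>n. C * norm (a n))"
    using assms by (intro summable_mult)
  show "norm (norm (z n * a n)) \<le> C * norm (a n)" if "n \<ge> 0" for n
    using assms(2)[of n] by (auto simp: norm_mult intro: mult_right_mono)
qed

text \<open>
  The product of the two series converges absolutely as a sum over pairs \<open>(d, e)\<close>. Grouped by
  \<open>n = d e\<close>, the coefficient of \<open>1 / n^s\<close> is the sum of \<open>\<mu>(d)\<close> over \<open>d dvd n\<close>, so only \<open>n = 1\<close>
  contributes.
\<close>
lemma moebius_series_times_zeta_series:
  assumes "s \<ge> 2"
  shows   "(\<Sum>n. moebius_mu (Suc n) / of_nat (Suc n) ^ s) * (\<Sum>n. 1 / of_nat (Suc n) ^ s) = 1"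
    (is "suminf ?u * suminf ?v = 1")
proof -
  define P where "P = {0::nat<..}"
  define f where "f = (\<lambda>n. moebius_mu n / of_nat n ^ s)"
  define g where "g = (\<lambda>n. 1 / of_nat n ^ s :: complex)"
  have bij: "bij_betw Suc UNIV P"
    by (auto simp: bij_betw_def P_def image_iff gr0_conv_Suc)
  have vsum: "summable (\<lambda>n. norm (?v n))"
    by (rule summable_inverse_Suc_power[OF assms])
  have usum: "summable (\<lambda>n. norm (?u n))"
    using summable_bounded_mult[OF vsum, of "\<lambda>n. moebius_mu (Suc n)" 1] norm_moebius_mu_le
    by simp
  have to_P: "(h has_sum suminf (\<lambda>n. h (Suc n))) P \<and> (\<lambda>n. norm (h n)) summable_on P"
    if h: "summable (\<lambda>n. norm (h (Suc n)))" for h :: "nat \<Rightarrow> complex"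
  proof
    have "((\<lambda>n. h (Suc n)) has_sum suminf (\<lambda>n. h (Suc n))) UNIV"
      by (rule norm_summable_imp_has_sum[OF h]) (use h in \<open>blast intro: summable_sums summable_norm_cancel\<close>)
    thus "(h has_sum suminf (\<lambda>n. h (Suc n))) P"
      using has_sum_reindex_bij_betw[OF bij] by blast
    have "(\<lambda>n. norm (h (Suc n))) summable_on UNIV"
      by (subst summable_on_UNIV_nonneg_real_iff) (use h in auto)
    thus "(\<lambda>n. norm (h n)) summable_on P"
      using summable_on_reindex_bij_betw[OF bij, of "\<lambda>n. norm (h n)"] by simp
  qed
  have f: "(f has_sum suminf ?u) P" "(\<lambda>d. norm (f d)) summable_on P"
    using to_P[of f] usum by (simp_all add: f_def)
  have g: "(g has_sum suminf ?v) P" "(\<lambda>e. norm (g e)) summable_on P"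
    using to_P[of g] vsum by (simp_all add: g_def)
  have abs: "(\<lambda>de. norm ((\<lambda>(d, e). f d * g e) de)) summable_on (P \<times> P)"
  proof (rule summable_on_SigmaI)
    show "((\<lambda>e. norm ((\<lambda>(d, e). f d * g e) (d, e))) has_sum norm (f d) * infsum (\<lambda>e. norm (g e)) P) P"
      for d using g(2) by (auto simp: norm_mult intro!: has_sum_cmult_right)
    show "(\<lambda>d. norm (f d) * infsum (\<lambda>e. norm (g e)) P) summable_on P"
      by (rule summable_on_cmult_left[OF f(2)])
  qed auto
  have prod: "((\<lambda>(d, e). f d * g e) has_sum suminf ?u * suminf ?v) (P \<times> P)"
    by (rule has_sum_SigmaI[where g = "\<lambda>d. f d * suminf ?v"])
       (use f g abs in \<open>auto intro: has_sum_cmult_left has_sum_cmult_right abs_summable_summable\<close>)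
  \<comment> \<open>Replace the pair \<open>(d, e)\<close> by \<open>(d e, d)\<close>, so that the summand becomes \<open>\<mu>(d) / (d e)^s\<close>.\<close>
  have "((\<lambda>(n, d). moebius_mu d * g n) has_sum suminf ?u * suminf ?v) (Sigma P (\<lambda>n. {d. d dvd n}))"
    using prod
    by (subst (asm) has_sum_reindex_bij_witness[where
          j = "\<lambda>(d, e). (d * e, d)" and i = "\<lambda>(n, d). (d, n div d)"
          and T = "Sigma P (\<lambda>n. {d. d dvd n})"])
       (auto simp: P_def f_def g_def power_mult_distrib elim!: dvdE)
  hence "((\<lambda>n. if n = 1 then 1 else 0) has_sum suminf ?u * suminf ?v) P"
  proof (rule has_sum_SigmaD)
    fix n assume n: "n \<in> P"
    hence "((\<lambda>d. moebius_mu d * g n) has_sum (\<Sum>d | d dvd n. moebius_mu d * g n)) {d. d dvd n}"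
      by (intro has_sum_finite) (auto simp: P_def)
    also have "(\<Sum>d | d dvd n. moebius_mu d * g n) = (if n = 1 then 1 else 0) * g n"
      using n sum_moebius_mu_divisors[of n] by (simp only: sum_distrib_right[symmetric] P_def greaterThan_iff)
    also have "\<dots> = (if n = 1 then 1 else 0)"
      by (simp add: g_def)
    finally show "((\<lambda>d. (\<lambda>(n, d). moebius_mu d * g n) (n, d)) has_sum (if n = 1 then 1 else 0)) {d. d dvd n}"
      by simp
  qed
  moreover have "((\<lambda>n. if n = 1 then 1 else 0) has_sum (1 :: complex)) P"
    by (rule has_sum_finite_neutralI[where B = "{1}"]) (auto simp: P_def)
  ultimately show ?thesis
    using has_sum_unique by blast
qed

text \<open>
  The exponent is split as \<open>2 + 2 k\<close> to exhibit the values as moments: weights \<open>\<mu>(n) / n^2\<close>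
  independent of \<open>k\<close>, points \<open>1 / n^2\<close>.
\<close>
lemma inverse_zeta_even_sums:
  "(\<lambda>n. moebius_mu (Suc n) / of_nat (Suc n) ^ 2 * (1 / of_nat (Suc n) ^ 2) ^ k)
     sums (1 / riemann_zeta (2 * of_nat k + 2))"
proof -
  define s where "s = 2 * k + 2"
  have s: "s \<ge> 2" "s > 0" "2 * of_nat k + 2 = (of_nat s :: complex)"
    by (simp_all add: s_def)
  have "(of_nat (Suc n) :: complex) powr of_nat s = of_nat (Suc n) ^ s" for n
    using s(2) powr_nat'[of "of_nat (Suc n) :: complex" s] by (simp del: of_nat_Suc)
  moreover have "Re (of_nat s) > 1"
    using s(1) by simp
  ultimately have "riemann_zeta (of_nat s) = (\<Sum>n. 1 / of_nat (Suc n) ^ s)"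
    by (simp only: riemann_zeta_def zeta_series_def if_True)
  moreover have "(\<Sum>n. moebius_mu (Suc n) / of_nat (Suc n) ^ s) * (\<Sum>n. 1 / of_nat (Suc n) ^ s) = 1"
    by (rule moebius_series_times_zeta_series[OF s(1)])
  ultimately have "(\<Sum>n. moebius_mu (Suc n) / of_nat (Suc n) ^ s) = 1 / riemann_zeta (of_nat s)"
    by (metis inverse_unique mult.commute inverse_eq_divide)
  moreover have "summable (\<lambda>n. moebius_mu (Suc n) * (1 / of_nat (Suc n) ^ s))"
    by (rule summable_norm_cancel[OF summable_bounded_mult[OF summable_inverse_Suc_power[OF s(1)]]])
       (rule norm_moebius_mu_le)
  ultimately have "(\<lambda>n. moebius_mu (Suc n) / of_nat (Suc n) ^ s) sums (1 / riemann_zeta (of_nat s))"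
    by (simp only: sums_iff times_divide_eq_right mult_1_right)
  moreover have "m / N ^ s = m / N ^ 2 * (1 / N ^ 2) ^ k" for m N :: complex
    unfolding s_def power_add power_mult power_one_over by simp
  ultimately show ?thesis
    by (simp only: s(3))
qed

section \<open>Generating functions of moment sequences\<close>

text \<open>
  The ratios \<open>z n\<close> may accumulate at the unit circle, so \<open>\<Sum>n k. norm (a n * z n ^ k)\<close> can diverge
  and Fubini does not apply. Finite sums over \<open>k\<close> can be exchanged with the sum over \<open>n\<close>, and the
  resulting \<open>(1 - z n ^ K) / (1 - z n)\<close> is at most \<open>2 / \<delta>\<close> in norm, which gives the domination for
  the limit \<open>K \<rightarrow> \<infinity>\<close>.
\<close>
lemma sums_geometric_mixture:
  fixes a z :: "nat \<Rightarrow> complex"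
  assumes a: "summable (\<lambda>n. norm (a n))"
    and z: "\<And>n. norm (z n) < 1"
    and \<delta>: "\<delta> > 0" "\<And>n. norm (1 - z n) \<ge> \<delta>"
  shows "(\<lambda>k. \<Sum>n. a n * z n ^ k) sums (\<Sum>n. a n / (1 - z n))"
proof -
  let ?w = "\<lambda>K n. a n * ((1 - z n ^ K) / (1 - z n))"
  have ne: "z n \<noteq> 1" for n
    using z[of n] by auto
  have partial: "(\<Sum>k<K. \<Sum>n. a n * z n ^ k) = (\<Sum>n. ?w K n)" for K
  proof -
    have "summable (\<lambda>n. z n ^ k * a n)" for k
    proof (intro summable_norm_cancel[OF summable_bounded_mult[OF a]])
      show "norm (z n ^ k) \<le> 1" for n
        using z[of n] by (simp add: norm_power power_le_one)
    qed
    hence "summable (\<lambda>n. a n * z n ^ k)" for k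
      by (simp add: mult.commute)
    hence "(\<lambda>n. \<Sum>k<K. a n * z n ^ k) sums (\<Sum>k<K. \<Sum>n. a n * z n ^ k)"
      by (intro sums_sum summable_sums)
    moreover have "(\<Sum>k<K. a n * z n ^ k) = ?w K n" for n
      using ne by (simp add: sum_distrib_left[symmetric] sum_gp_strict)
    ultimately show ?thesis
      by (simp add: sums_iff)
  qed
  have "(\<lambda>K. \<Sum>n. ?w K n) \<longlonglongrightarrow> (\<Sum>n. a n * ((1 - 0) / (1 - z n)))"
  proof (rule tannerys_theorem[THEN conjunct2, THEN conjunct2])
    show "(\<lambda>K. ?w K n) \<longlonglongrightarrow> a n * ((1 - 0) / (1 - z n))" for n
      using z ne by (intro tendsto_intros LIMSEQ_power_zero) auto
    show "\<forall>\<^sub>F (n, K) in at_top \<times>\<^sub>F sequentially. norm (?w K n) \<le> norm (a n) * (2 / \<delta>)"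
    proof (intro always_eventually allI, clarify)
      fix n K
      have "norm (1 - z n ^ K) \<le> norm (1 :: complex) + norm (z n ^ K)"
        by (rule norm_triangle_ineq4)
      also have "norm (z n ^ K) \<le> 1"
        using z[of n] by (simp add: norm_power power_le_one)
      finally have "norm (1 - z n ^ K) \<le> 2"
        by simp
      hence "norm ((1 - z n ^ K) / (1 - z n)) \<le> 2 / \<delta>"
        using \<delta>(1) \<delta>(2)[of n] by (auto simp: norm_divide intro: frac_le)
      thus "norm (?w K n) \<le> norm (a n) * (2 / \<delta>)"
        unfolding norm_mult by (intro mult_left_mono) auto
    qed
    show "summable (\<lambda>n. norm (a n) * (2 / \<delta>))"
      using a by (rule summable_mult2)
  qed auto
  thus ?thesis
    by (simp add: sums_def partial)
qed

lemma binomial_transform_sums: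
  fixes a y :: "nat \<Rightarrow> complex"
  assumes "\<And>j. (\<lambda>n. a n * y n ^ j) sums b j"
  shows   "(\<lambda>n. a n * (1 - y n) ^ k) sums (\<Sum>j=0..k. (-1) ^ j * of_nat (k choose j) * b j)"
proof -
  have "(\<lambda>n. \<Sum>j=0..k. (-1) ^ j * of_nat (k choose j) * (a n * y n ^ j))
          sums (\<Sum>j=0..k. (-1) ^ j * of_nat (k choose j) * b j)"
    by (intro sums_sum sums_mult assms)
  moreover have "(\<Sum>j=0..k. (-1) ^ j * of_nat (k choose j) * (a n * y n ^ j)) = a n * (1 - y n) ^ k" for n
  proof -
    have "(1 - y n) ^ k = (\<Sum>j\<le>k. of_nat (k choose j) * (- y n) ^ j)"
      using binomial_ring[of "- y n" 1 k] by simp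
    also have "a n * \<dots> = (\<Sum>j\<le>k. (-1) ^ j * of_nat (k choose j) * (a n * y n ^ j))"
      by (subst sum_distrib_left, intro sum.cong refl, subst power_minus) (simp add: mult_ac)
    finally show ?thesis
      by (simp add: atLeast0AtMost)
  qed
  ultimately show ?thesis
    by simp
qed

text \<open>
  For \<open>-1 \<le> t < 1/2\<close> both families of ratios satisfy the hypotheses of \<open>sums_geometric_mixture\<close>:
  \<open>t * (1 - y n)\<close> has modulus below \<open>1\<close> because \<open>y n > 0\<close> and is at most \<open>1/2\<close>, while \<open>x * y n\<close> is
  at most \<open>norm x < 1\<close> in modulus. The condition \<open>norm x < 1\<close> is precisely \<open>t < 1/2\<close>.
  Both series are compared with the common value \<open>\<Sum>n. a n / (1 - t * (1 - y n))\<close>.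
\<close>
lemma mixture_euler_transform:
  fixes a b :: "nat \<Rightarrow> complex" and y :: "nat \<Rightarrow> real" and t :: real
  assumes a: "summable (\<lambda>n. norm (a n))"
    and y: "\<And>n. 0 < y n" "\<And>n. y n \<le> 1"
    and b: "\<And>j. (\<lambda>n. a n * of_real (y n) ^ j) sums b j"
    and t: "-1 \<le> t" "t < 1/2"
  defines "x \<equiv> - (t / (1 - t))"
    and "c \<equiv> \<lambda>k. \<Sum>j=0..k. (-1) ^ j * of_nat (k choose j) * b j"
  shows "(\<lambda>k. c k * of_real t ^ k) sums (\<Sum>n. a n / of_real (1 - t * (1 - y n)))"
    and "(\<lambda>k. of_real x ^ k * b k) sums (of_real (1 - t) * (\<Sum>n. a n / of_real (1 - t * (1 - y n))))"
proof -
  have c: "c k * of_real t ^ k = (\<Sum>n. a n * of_real (t * (1 - y n)) ^ k)" for k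
  proof -
    have "(\<lambda>n. a n * (1 - of_real (y n)) ^ k) sums c k"
      unfolding c_def by (rule binomial_transform_sums[OF b])
    from sums_mult2[OF this, of "of_real t ^ k"] show ?thesis
      by (simp add: sums_iff power_mult_distrib mult_ac)
  qed
  have t_le: "t * (1 - y n) \<le> 1/2" for n
  proof -
    have "t * (1 - y n) \<le> 1/2 * (1 - y n)"
      using t y(2)[of n] by (intro mult_right_mono) auto
    with y(1)[of n] show ?thesis by simp
  qed
  have "norm (of_real (t * (1 - y n)) :: complex) < 1" for n
  proof -
    have "\<bar>t\<bar> * \<bar>1 - y n\<bar> \<le> 1 * \<bar>1 - y n\<bar>"
      using t by (intro mult_right_mono) auto
    also have "\<dots> < 1"
      using y[of n] by simp
    finally show ?thesis
      by (simp only: norm_of_real abs_mult)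
  qed
  moreover have "norm (1 - of_real (t * (1 - y n)) :: complex) \<ge> 1/2" for n
  proof -
    have "norm (of_real (1 - t * (1 - y n)) :: complex) \<ge> 1/2"
      unfolding norm_of_real using t_le[of n] by linarith
    thus ?thesis by (simp only: of_real_diff of_real_1)
  qed
  ultimately have "(\<lambda>k. \<Sum>n. a n * of_real (t * (1 - y n)) ^ k)
                     sums (\<Sum>n. a n / (1 - of_real (t * (1 - y n))))"
    by (intro sums_geometric_mixture[OF a, where \<delta> = "1/2"]) auto
  thus left: "(\<lambda>k. c k * of_real t ^ k) sums (\<Sum>n. a n / of_real (1 - t * (1 - y n)))"
    by (simp only: c of_real_diff of_real_1)

  have x: "\<bar>x\<bar> < 1"
    using t by (auto simp: x_def field_simps abs_less_iff)
  have xy: "\<bar>x * y n\<bar> \<le> \<bar>x\<bar>" for n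
    using y[of n] by (simp add: abs_mult mult_left_le)
  have "norm (of_real (x * y n) :: complex) < 1" for n
    unfolding norm_of_real using xy[of n] x by linarith
  moreover have "norm (1 - of_real (x * y n) :: complex) \<ge> 1 - \<bar>x\<bar>" for n
  proof -
    have "norm (of_real (1 - x * y n) :: complex) \<ge> 1 - \<bar>x\<bar>"
      unfolding norm_of_real using xy[of n] by linarith
    thus ?thesis by (simp only: of_real_diff of_real_1)
  qed
  ultimately have right: "(\<lambda>k. \<Sum>n. a n * of_real (x * y n) ^ k) sums (\<Sum>n. a n / (1 - of_real (x * y n)))"
    using x by (intro sums_geometric_mixture[OF a, where \<delta> = "1 - \<bar>x\<bar>"]) auto
  have coeff: "(\<Sum>n. a n * of_real (x * y n) ^ k) = of_real x ^ k * b k" for k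
    using sums_mult[OF b, of "of_real x ^ k" k]
    by (simp add: sums_iff power_mult_distrib mult_ac)
  have "a n / (1 - of_real (x * y n)) = of_real (1 - t) * (a n / of_real (1 - t * (1 - y n)))" for n
  proof -
    have pos: "1 - t * (1 - y n) > 0" "1 - t > 0"
      using t_le[of n] t by linarith+
    have "1 - x * y n = (1 - t * (1 - y n)) / (1 - t)"
      using t by (simp add: x_def field_simps)
    hence "1 - complex_of_real (x * y n) = of_real (1 - t * (1 - y n)) / of_real (1 - t)"
      by (metis of_real_1 of_real_diff of_real_divide)
    thus ?thesis
      by simp
  qed
  moreover have "summable (\<lambda>n. a n / of_real (1 - t * (1 - y n)))"
  proof (rule summable_norm_cancel)
    have "norm (1 / of_real (1 - t * (1 - y n)) :: complex) \<le> 2" for n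
      using t_le[of n] by (simp only: norm_divide norm_of_real norm_one) (simp add: field_simps)
    from summable_bounded_mult[OF a this]
    show "summable (\<lambda>n. norm (a n / complex_of_real (1 - t * (1 - y n))))"
      by simp
  qed
  ultimately show "(\<lambda>k. of_real x ^ k * b k) sums
      (of_real (1 - t) * (\<Sum>n. a n / of_real (1 - t * (1 - y n))))"
    using right by (simp only: coeff suminf_mult)
qed

section \<open>The generating function of the Baez-Duarte sequence\<close>

theorem mainTheorem4:
  fixes t :: real
  assumes "-1 \<le> t" and "t < 1/2"
  shows "summable (\<lambda>k. baez_duarte k * complex_of_real t ^ k)
    \<and> summable (\<lambda>k. complex_of_real (- (t / (1 - t))) ^ k * (1 / riemann_zeta (2 * of_nat k + 2)))
    \<and> (\<Sum>k. baez_duarte k * complex_of_real t ^ k)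
        = complex_of_real (1 / (1 - t))
          * (\<Sum>k. complex_of_real (- (t / (1 - t))) ^ k * (1 / riemann_zeta (2 * of_nat k + 2)))"
proof -
  define a where "a = (\<lambda>n. moebius_mu (Suc n) / of_nat (Suc n) ^ 2)"
  define y where "y = (\<lambda>n. 1 / real (Suc n) ^ 2)"
  define b where "b = (\<lambda>k. 1 / riemann_zeta (2 * of_nat k + 2))"
  define S where "S = (\<Sum>n. a n / of_real (1 - t * (1 - y n)))"
  have a: "summable (\<lambda>n. norm (a n))"
    using summable_bounded_mult[OF summable_inverse_Suc_power, of 2 "\<lambda>n. moebius_mu (Suc n)" 1]
          norm_moebius_mu_le
    by (simp add: a_def)
  have y: "0 < y n" "y n \<le> 1" for n
    by (simp_all add: y_def)
  have b: "(\<lambda>n. a n * of_real (y n) ^ j) sums b j" for j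
    using inverse_zeta_even_sums[of j] by (simp add: a_def b_def y_def)
  note euler = mixture_euler_transform[OF a y b assms, folded S_def, unfolded b_def,
      folded baez_duarte_def]
  have "complex_of_real (1 / (1 - t)) * of_real (1 - t) = 1"
    unfolding of_real_mult[symmetric] using assms by simp
  hence "complex_of_real (1 / (1 - t)) * (of_real (1 - t) * S) = S"
    by (simp only: mult.assoc[symmetric] mult_1_left)
  with euler show ?thesis
    by (auto simp only: sums_iff)
qed

end
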